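(* Let $\beta:\mathbb{R}_+\times\mathbb{R}_+\to\mathbb{R}_+$. If $\beta(y,t)$ is differentiable in $t$, normalized, and time-invariant, then $$\partial_t\beta(y,t)=\rho(\beta(y,t)),\qquad \beta(y,0)=y,\qquad \forall y,t\ge 0,\qquad (\ast)$$ where $\rho(y):=\partial_t\beta(y,t)|_{t=0}$. Conversely, for any $\rho:\mathbb{R}_+\to\mathbb{R}$, if there exists a unique and continuous function $\beta:\mathbb{R}_+\times\mathbb{R}_+\to\mathbb{R}_+$ that satisfies $(\ast)$, then $\beta$ is normalized and time-invariant.
   Context: $\mathbb{R}_+=[0,\infty)$. $\beta:\mathbb{R}_+\times\mathbb{R}_+\to\mathbb{R}_+$ is normalized if $\beta(y,0)=y$ for all $y\ge0$; it is time-invariant if $\beta$ is continuous and for all $y,z,t_0\ge0$, $\beta(y,t_0)=\beta(z,0)$ implies $\beta(y,t_0+t)=\beta(z,t)$ for all $t\ge0$. At $t=0$ derivatives in $t$ are one-sided (right) derivatives. *)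

theory Defs
  imports "HOL-Analysis.Analysis"
begin

text \<open>
  A function \<open>\<beta> : [0,\<infinity>) \<times> [0,\<infinity>) \<rightarrow> [0,\<infinity>)\<close> is represented by a curried total function on the
  reals of which only the values at nonnegative arguments matter: every definition below
  depends only on these values.
\<close>

definition nonneg_map :: "(real \<Rightarrow> real \<Rightarrow> real) \<Rightarrow> bool" where
  "nonneg_map \<beta> \<longleftrightarrow> (\<forall>y\<ge>0. \<forall>t\<ge>0. 0 \<le> \<beta> y t)"

definition jointly_continuous :: "(real \<Rightarrow> real \<Rightarrow> real) \<Rightarrow> bool" where
  "jointly_continuous \<beta> \<longleftrightarrow> continuous_on ({0..} \<times> {0..}) (\<lambda>(y, t). \<beta> y t)"

definition normalized :: "(real \<Rightarrow> real \<Rightarrow> real) \<Rightarrow> bool" where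
  "normalized \<beta> \<longleftrightarrow> (\<forall>y\<ge>0. \<beta> y 0 = y)"

definition time_invariant :: "(real \<Rightarrow> real \<Rightarrow> real) \<Rightarrow> bool" where
  "time_invariant \<beta> \<longleftrightarrow> jointly_continuous \<beta> \<and>
     (\<forall>y\<ge>0. \<forall>z\<ge>0. \<forall>t0\<ge>0. \<beta> y t0 = \<beta> z 0 \<longrightarrow> (\<forall>t\<ge>0. \<beta> y (t0 + t) = \<beta> z t))"

text \<open>
  Derivatives in \<open>t\<close> are taken within \<open>[0,\<infinity>)\<close>, hence they are one-sided at \<open>t = 0\<close> and
  ordinary two-sided derivatives at \<open>t > 0\<close>.
\<close>

definition differentiable_in_time :: "(real \<Rightarrow> real \<Rightarrow> real) \<Rightarrow> bool" where
  "differentiable_in_time \<beta> \<longleftrightarrow> (\<forall>y\<ge>0. (\<lambda>t. \<beta> y t) differentiable_on {0..})"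

definition initial_rate :: "(real \<Rightarrow> real \<Rightarrow> real) \<Rightarrow> real \<Rightarrow> real" where
  "initial_rate \<beta> y = vector_derivative (\<lambda>t. \<beta> y t) (at 0 within {0..})"

definition solves_ivp :: "(real \<Rightarrow> real) \<Rightarrow> (real \<Rightarrow> real \<Rightarrow> real) \<Rightarrow> bool" where
  "solves_ivp \<rho> \<beta> \<longleftrightarrow>
     (\<forall>y\<ge>0. \<forall>t\<ge>0. ((\<lambda>s. \<beta> y s) has_real_derivative \<rho> (\<beta> y t)) (at t within {0..}) \<and> \<beta> y 0 = y)"

text \<open>
  Competing solutions are not required to be continuous in both arguments jointly, and
  uniqueness means agreement at nonnegative arguments.
\<close>

definition unique_solution :: "(real \<Rightarrow> real) \<Rightarrow> (real \<Rightarrow> real \<Rightarrow> real) \<Rightarrow> bool" where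
  "unique_solution \<rho> \<beta> \<longleftrightarrow> nonneg_map \<beta> \<and> solves_ivp \<rho> \<beta> \<and>
     (\<forall>\<gamma>. nonneg_map \<gamma> \<and> solves_ivp \<rho> \<gamma> \<longrightarrow> (\<forall>y\<ge>0. \<forall>t\<ge>0. \<gamma> y t = \<beta> y t))"

end

theory Submission
  imports Defs
begin

text \<open>
  Both directions rest on one observation: for a fixed delay \<open>a \<ge> 0\<close>, the delayed trajectory
  \<open>s \<mapsto> \<beta> y (a + s)\<close> is again differentiable on \<open>[0,\<infinity>)\<close>, with the delayed derivative
  (\<open>has_real_derivative_delay\<close>).

  If \<open>\<beta>\<close> is normalized and time-invariant, the trajectory from \<open>y\<close> delayed by \<open>t\<close> coincides with the
  trajectory from \<open>\<beta> y t\<close>. The derivative of the former at \<open>0\<close> is the time derivative of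
  \<open>\<beta> y\<close> at \<open>t\<close>, and that of the latter is the initial rate at \<open>\<beta> y t\<close>; one-sided derivatives are
  unique, so the two agree.

  Conversely, let \<open>\<beta>\<close> be the unique solution and \<open>\<beta> y t\<^sub>0 = z\<close>. Since the equation is autonomous,
  the trajectory from \<open>y\<close> delayed by \<open>t\<^sub>0\<close> is a solution starting at \<open>z\<close>. Uniqueness concerns
  whole families of trajectories, so this one is spliced into \<open>\<beta>\<close> in place of the trajectory from
  \<open>z\<close>; the spliced family solves the same problem, hence equals \<open>\<beta>\<close>.
\<close>

lemma has_real_derivative_delay:
  fixes f :: "real \<Rightarrow> real"
  assumes "(f has_real_derivative D) (at (a + t) within {0..})" and "0 \<le> a"
  shows "((\<lambda>s. f (a + s)) has_real_derivative D) (at t within {0..})"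
proof -
  have "(f has_real_derivative D) (at (a + t) within (\<lambda>s. a + s) ` {0..})"
    using assms(1) by (rule DERIV_subset) (use assms(2) in auto)
  moreover have "((\<lambda>s. a + s) has_real_derivative 1) (at t within {0..})"
    by (auto intro!: derivative_eq_intros)
  ultimately show ?thesis
    using DERIV_image_chain[of f D "\<lambda>s. a + s" t "{0..}" 1] by (simp add: o_def)
qed

lemma initial_rate_eqI:
  assumes "(\<beta> y has_real_derivative D) (at 0 within {0..})"
  shows "initial_rate \<beta> y = D"
  unfolding initial_rate_def
proof (rule vector_derivative_within)
  show "at (0::real) within {0..} \<noteq> bot"
    by (simp add: at_within_Ici_at_right)
  show "(\<beta> y has_vector_derivative D) (at 0 within {0..})"
    using assms by (simp add: has_real_derivative_iff_has_vector_derivative)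
qed

lemma time_invariant_imp_solves_ivp:
  assumes nonneg: "nonneg_map \<beta>" and diff: "differentiable_in_time \<beta>"
    and norm: "normalized \<beta>" and inv: "time_invariant \<beta>"
  shows "solves_ivp (initial_rate \<beta>) \<beta>"
  unfolding solves_ivp_def
proof (intro allI impI conjI)
  fix y t :: real
  assume y: "0 \<le> y" and t: "0 \<le> t"
  show "\<beta> y 0 = y"
    using norm y by (simp add: normalized_def)
  define z where "z = \<beta> y t"
  have z: "0 \<le> z"
    using nonneg y t by (simp add: nonneg_map_def z_def)
  have semigroup: "\<beta> z s = \<beta> y (t + s)" if "0 \<le> s" for s
    using inv norm y z t that by (simp add: time_invariant_def normalized_def z_def)
  obtain D where D: "(\<beta> y has_real_derivative D) (at t within {0..})"
    using diff y t
    by (auto simp: differentiable_in_time_def differentiable_on_def real_differentiable_def)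
  have "((\<lambda>s. \<beta> y (t + s)) has_real_derivative D) (at 0 within {0..})"
    using D t by (intro has_real_derivative_delay) simp_all
  then have "(\<beta> z has_real_derivative D) (at 0 within {0..})"
    by (rule has_field_derivative_transform_within[where d = 1]) (auto simp: semigroup)
  then have "initial_rate \<beta> z = D"
    by (rule initial_rate_eqI)
  with D show "(\<beta> y has_real_derivative initial_rate \<beta> (\<beta> y t)) (at t within {0..})"
    by (simp add: z_def)
qed

text \<open>
  The delayed trajectory starts at \<open>\<beta> y a\<close>, so it satisfies the initial condition exactly when it
  is installed as the trajectory from that point; the other trajectories can stay as they are
  because the problem does not couple different initial values.
\<close>

lemma solves_ivp_splice_delayed:
  assumes sol: "solves_ivp \<rho> \<beta>" and y: "0 \<le> y" and a: "0 \<le> a"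
  shows "solves_ivp \<rho> (\<beta>(\<beta> y a := \<lambda>t. \<beta> y (a + t)))"
proof -
  have "((\<lambda>s. \<beta> y (a + s)) has_real_derivative \<rho> (\<beta> y (a + t))) (at t within {0..})"
    if "0 \<le> t" for t
    using sol y a that by (intro has_real_derivative_delay) (simp_all add: solves_ivp_def)
  then show ?thesis
    using sol by (simp add: solves_ivp_def)
qed

lemma unique_solution_imp_time_invariant:
  assumes uniq: "unique_solution \<rho> \<beta>" and cont: "jointly_continuous \<beta>"
  shows "time_invariant \<beta>"
  unfolding time_invariant_def
proof (intro conjI allI impI)
  show "jointly_continuous \<beta>" by (fact cont)
next
  fix y z a t :: real
  assume y: "0 \<le> y" and z: "0 \<le> z" and a: "0 \<le> a" and t: "0 \<le> t" and "\<beta> y a = \<beta> z 0"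
  have nonneg: "nonneg_map \<beta>" and sol: "solves_ivp \<rho> \<beta>"
    and unique: "\<And>\<gamma>. nonneg_map \<gamma> \<Longrightarrow> solves_ivp \<rho> \<gamma> \<Longrightarrow> \<gamma> z t = \<beta> z t"
    using uniq z t by (auto simp: unique_solution_def)
  have "\<beta> y a = z"
    using \<open>\<beta> y a = \<beta> z 0\<close> sol z by (auto simp: solves_ivp_def)
  then have "solves_ivp \<rho> (\<beta>(z := \<lambda>t. \<beta> y (a + t)))"
    using solves_ivp_splice_delayed[OF sol y a] by simp
  moreover have "nonneg_map (\<beta>(z := \<lambda>t. \<beta> y (a + t)))"
    using nonneg y a by (simp add: nonneg_map_def)
  ultimately show "\<beta> y (a + t) = \<beta> z t"
    using unique by fastforce
qed

theorem proposition14: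
  shows "(\<forall>\<beta> :: real \<Rightarrow> real \<Rightarrow> real.
            nonneg_map \<beta> \<and> differentiable_in_time \<beta> \<and> normalized \<beta> \<and> time_invariant \<beta> \<longrightarrow>
            solves_ivp (initial_rate \<beta>) \<beta>) \<and>
         (\<forall>(\<rho> :: real \<Rightarrow> real) (\<beta> :: real \<Rightarrow> real \<Rightarrow> real).
            unique_solution \<rho> \<beta> \<and> jointly_continuous \<beta> \<longrightarrow>
            normalized \<beta> \<and> time_invariant \<beta>)"
proof (intro conjI allI impI; elim conjE)
  fix \<beta> :: "real \<Rightarrow> real \<Rightarrow> real"
  assume "nonneg_map \<beta>" "differentiable_in_time \<beta>" "normalized \<beta>" "time_invariant \<beta>"
  then show "solves_ivp (initial_rate \<beta>) \<beta>"
    by (rule time_invariant_imp_solves_ivp)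
next
  fix \<rho> :: "real \<Rightarrow> real" and \<beta> :: "real \<Rightarrow> real \<Rightarrow> real"
  assume uniq: "unique_solution \<rho> \<beta>" and cont: "jointly_continuous \<beta>"
  show "normalized \<beta>"
    using uniq by (auto simp: unique_solution_def solves_ivp_def normalized_def)
  show "time_invariant \<beta>"
    using uniq cont by (rule unique_solution_imp_time_invariant)
qed

end
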